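(* Suppose the triple $(P,Q,R)$ of functions of $x$ satisfies Ramanujan's differential equations \begin{align*} \frac{dP}{dx}&=\frac{1}{6}(P^2-Q),\\ \frac{dQ}{dx}&=\frac{2}{3}(PQ-R),\\ \frac{dR}{dx}&=PR-Q^2. \end{align*} Let $\nu$ be a solution to the cubic equation $$\nu^3-\frac{3}{4}Q\nu+\frac{1}{4}R=0.$$ Then the triple $$(p,q,r)=\left(P-\nu,\;-Q+5\nu^2,\;\frac{11}{4}R-\frac{21}{4}Q\nu\right)$$ also satisfies Ramanujan's differential equations, i.e. $p'=\frac16(p^2-q)$, $q'=\frac23(pq-r)$, $r'=pr-q^2$.
   Context: $P,Q,R$ are functions of the variable $x$, and $'$ denotes $d/dx$. The quantity $\nu$, a root of a polynomial equation with coefficients depending on $x$, is a differentiable function of $x$ satisfying that equation identically in $x$. *)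

theory Defs
  imports "HOL-Analysis.Analysis"
begin

text \<open>
  Derivatives are taken with respect to a variable in a real normed field, so that both a real
  variable with real-valued functions and a complex variable with complex-valued functions are
  covered.  They are taken relative to the domain \<open>S\<close>: for open \<open>S\<close> this is the ordinary
  derivative; for \<open>S\<close> an interval, endpoints get one-sided derivatives; and for \<open>S\<close> a segment of
  the real axis inside the complex numbers it is the derivative of a complex-valued function of
  a real variable.
\<close>

definition ramanujan_system_on ::
  "'a::real_normed_field set \<Rightarrow> ('a \<Rightarrow> 'a) \<Rightarrow> ('a \<Rightarrow> 'a) \<Rightarrow> ('a \<Rightarrow> 'a) \<Rightarrow> bool"
  where "ramanujan_system_on S P Q R \<longleftrightarrow>
    (\<forall>x\<in>S.
      (P has_field_derivative 1 / 6 * ((P x)\<^sup>2 - Q x)) (at x within S) \<and>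
      (Q has_field_derivative 2 / 3 * (P x * Q x - R x)) (at x within S) \<and>
      (R has_field_derivative P x * R x - (Q x)\<^sup>2) (at x within S))"

end

theory Submission
  imports Defs
begin

text \<open>
  Everything reduces to the single formula \<open>3 \<nu>' = P \<nu> + 2 \<nu>\<^sup>2 - Q\<close>; given it, the three new
  differential equations are polynomial identities after substituting \<open>R = 3 Q \<nu> - 4 \<nu>\<^sup>3\<close>.

  Differentiating the cubic and eliminating \<open>R\<close> yields that formula multiplied by
  \<open>\<nu>\<^sup>2 - Q / 4\<close>, so it remains to treat the points where \<open>\<nu>\<close> is a multiple root, \<open>Q = 4 \<nu>\<^sup>2\<close>.
  There the discriminant \<open>\<Delta> = Q\<^sup>3 - R\<^sup>2\<close> vanishes.  Ramanujan's equations imply the linear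
  equation \<open>\<Delta>' = 2 P \<Delta>\<close>, so \<open>\<Delta>\<close> vanishes on a whole neighbourhood, by uniqueness for linear
  differential equations (lemma \<open>linear_bound_eventually_zero\<close>).  On the root, \<open>\<Delta>\<close> factors as
  \<open>(Q - 4 \<nu>\<^sup>2)\<^sup>2 (Q - \<nu>\<^sup>2)\<close>.

  If \<open>\<nu> \<noteq> 0\<close> at the point, the second factor is nonzero nearby by continuity.  Hence
  \<open>Q = 4 \<nu>\<^sup>2\<close> persists nearby and can be differentiated, which determines \<open>\<nu>'\<close>.  If \<open>\<nu> = 0\<close>
  at the point, then \<open>Q = R = 0\<close> there as well.  The pair \<open>(Q, R)\<close> satisfies a homogeneous
  linear system with locally bounded coefficients, so it vanishes nearby, and therefore so
  does \<open>\<nu>\<close>; the formula reads \<open>0 = 0\<close>.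
\<close>

section \<open>Functions whose derivative is bounded by their size\<close>

text \<open>
  A completeness-free form of the uniqueness argument: by the mean value inequality, a bound
  \<open>B\<close> for \<open>norm f\<close> on a ball of radius at most \<open>1 / (2 K)\<close> around \<open>x0\<close>, intersected with \<open>T\<close>,
  where \<open>K > 0\<close>, improves itself to \<open>B / 2\<close> on the same set, and hence to \<open>B / 2 ^ n\<close> for every \<open>n\<close>.
\<close>

lemma linear_bound_eventually_zero:
  fixes f :: "'a::real_normed_vector \<Rightarrow> 'b::real_normed_vector"
  assumes T: "convex T" "x0 \<in> T" and f0: "f x0 = 0"
    and deriv: "\<And>y. y \<in> T \<Longrightarrow> (f has_derivative f' y) (at y within T)"
    and bound: "\<And>y h. y \<in> T \<Longrightarrow> norm (f' y h) \<le> K * norm (f y) * norm h"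
  shows "\<forall>\<^sub>F y in at x0 within T. f y = 0"
proof -
  have "continuous (at x0 within T) f"
    using deriv T(2) has_derivative_continuous by blast
  then obtain d where d: "d > 0" "\<And>y. y \<in> T \<Longrightarrow> dist y x0 < d \<Longrightarrow> norm (f y) < 1"
    unfolding continuous_within_eps_delta f0 by (metis dist_0_norm dist_commute zero_less_one)
  \<comment> \<open>A positive bound, so that the radius below makes sense whatever the sign of \<open>K\<close>.\<close>
  define L where "L = max K 1"
  have L: "L > 0" "K \<le> L" by (auto simp: L_def)
  define e where "e = min d (1 / (2 * L))"
  have e: "e > 0" "e \<le> d" "L * e \<le> 1 / 2"
    using d(1) L(1) by (auto simp: e_def min_def field_simps)
  define U where "U = T \<inter> ball x0 e"
  have U: "convex U" "x0 \<in> U" "U \<subseteq> T"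
    using T e by (auto simp: U_def convex_Int)
  have halving: "norm (f y) \<le> (1 / 2) ^ n" if "y \<in> U" for y n
    using that
  proof (induction n arbitrary: y)
    case 0
    then show ?case using d(2)[of y] e(2) by (auto simp: U_def dist_commute less_imp_le)
  next
    case (Suc n)
    have "onorm (f' z) \<le> L * (1 / 2) ^ n" if z: "z \<in> U" for z
    proof (rule onorm_bound)
      show "0 \<le> L * (1 / 2) ^ n" using L(1) by simp
      fix h
      have "norm (f' z h) \<le> K * norm (f z) * norm h" using bound z U by blast
      also have "\<dots> \<le> L * (1 / 2) ^ n * norm h"
        by (intro mult_right_mono mult_mono L(2) Suc.IH z) (use L(1) in auto)
      finally show "norm (f' z h) \<le> L * (1 / 2) ^ n * norm h" .
    qed
    then have "norm (f y - f x0) \<le> L * (1 / 2) ^ n * norm (y - x0)"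
      by (intro differentiable_bound[OF U(1) _ _ Suc.prems U(2)])
        (use deriv U(3) in \<open>blast intro: has_derivative_subset\<close>, assumption)
    also have "\<dots> \<le> L * (1 / 2) ^ n * e"
      using Suc.prems L(1) by (intro mult_left_mono) (auto simp: U_def dist_norm norm_minus_commute)
    also have "\<dots> = (1 / 2) ^ n * (L * e)" by simp
    also have "\<dots> \<le> (1 / 2) ^ n * (1 / 2)" by (intro mult_left_mono e(3)) simp
    finally show ?case by (simp add: f0)
  qed
  have "f y = 0" if "y \<in> U" for y
  proof -
    have "(\<lambda>n. (1 / 2 :: real) ^ n) \<longlonglongrightarrow> 0" by (rule LIMSEQ_power_zero) simp
    then have "norm (f y) \<le> 0"
      by (rule LIMSEQ_le_const) (use halving[OF that] in blast)
    then show ?thesis by simp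
  qed
  then show ?thesis
    unfolding eventually_at using e(1) by (auto simp: U_def dist_commute)
qed

section \<open>Derivatives relative to a set\<close>

lemma has_field_derivative_within_unique:
  fixes f :: "'a::real_normed_field \<Rightarrow> 'a"
  assumes "(f has_field_derivative a) (at x within S)"
    and "(f has_field_derivative b) (at x within S)"
    and "at x within S \<noteq> bot"
  shows "a = b"
  using assms unfolding has_field_derivative_iff by (metis tendsto_unique)

lemma has_field_derivative_eventually_zero:
  fixes f :: "'a::real_normed_field \<Rightarrow> 'a"
  assumes "\<forall>\<^sub>F y in at x within S. f y = 0" and "f x = 0"
  shows "(f has_field_derivative 0) (at x within S)"
  using assms unfolding has_field_derivative_iff
  by (auto intro!: tendsto_eventually elim: eventually_mono)

section \<open>Local uniqueness for Ramanujan's system\<close>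

text \<open>
  Uniqueness is a local matter, so it suffices that small enough balls meet \<open>S\<close> in a convex
  set on which the coefficients of the linear equations are bounded.
\<close>

lemma ramanujan_system_bounded_convex_neighbourhood:
  fixes S :: "'a::real_normed_field set"
  assumes S: "open S \<or> convex S" and sys: "ramanujan_system_on S P Q R" and x: "x \<in> S"
  obtains T M where "convex T" "x \<in> T" "at x within T = at x within S"
    "ramanujan_system_on T P Q R" "M \<ge> 0"
    "\<And>y. y \<in> T \<Longrightarrow> norm (P y) \<le> M" "\<And>y. y \<in> T \<Longrightarrow> norm (Q y) \<le> M"
proof -
  have "continuous (at x within S) P" "continuous (at x within S) Q"
    using sys x DERIV_continuous unfolding ramanujan_system_on_def by blast+
  then have "\<exists>d>0. \<forall>y\<in>S. dist y x < d \<longrightarrow> dist (P y) (P x) < 1"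
    "\<exists>d>0. \<forall>y\<in>S. dist y x < d \<longrightarrow> dist (Q y) (Q x) < 1"
    unfolding continuous_within_eps_delta by simp_all
  then obtain d1 d2
    where d1: "d1 > 0" "\<And>y. y \<in> S \<Longrightarrow> dist y x < d1 \<Longrightarrow> dist (P y) (P x) < 1"
      and d2: "d2 > 0" "\<And>y. y \<in> S \<Longrightarrow> dist y x < d2 \<Longrightarrow> dist (Q y) (Q x) < 1"
    by blast
  obtain d3 where d3: "d3 > 0" "open S \<Longrightarrow> ball x d3 \<subseteq> S"
    using x by (cases "open S") (auto elim: openE intro: zero_less_one)
  define d where "d = min d1 (min d2 d3)"
  define T where "T = S \<inter> ball x d"
  have d: "d > 0" "d \<le> d1" "d \<le> d2" "d \<le> d3" using d1 d2 d3 by (auto simp: d_def)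
  have "convex T"
  proof (cases "open S")
    case True
    then have "T = ball x d" using d3(2) d(4) by (auto simp: T_def)
    then show ?thesis by simp
  next
    case False
    then show ?thesis using S by (auto simp: T_def convex_Int)
  qed
  moreover have "x \<in> T" using x d(1) by (simp add: T_def)
  moreover have "at x within T = at x within S"
    by (rule at_within_nhd[where S = "ball x d"]) (use d(1) in \<open>auto simp: T_def\<close>)
  moreover have "ramanujan_system_on T P Q R"
    using sys unfolding ramanujan_system_on_def
    by (auto simp: T_def intro: DERIV_subset)
  moreover have "norm (P y) \<le> norm (P x) + norm (Q x) + 1"
    "norm (Q y) \<le> norm (P x) + norm (Q x) + 1" if "y \<in> T" for y
  proof -
    have "dist (P y) (P x) < 1" "dist (Q y) (Q x) < 1"
      using that d1(2)[of y] d2(2)[of y] d by (auto simp: T_def dist_commute)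
    then show "norm (P y) \<le> norm (P x) + norm (Q x) + 1"
      "norm (Q y) \<le> norm (P x) + norm (Q x) + 1"
      using norm_triangle_ineq2[of "P y" "P x"] norm_triangle_ineq2[of "Q y" "Q x"]
        norm_ge_zero[of "P x"] norm_ge_zero[of "Q x"]
      unfolding dist_norm by linarith+
  qed
  ultimately show thesis by (intro that[of T "norm (P x) + norm (Q x) + 1"]) auto
qed

text \<open>The discriminant satisfies \<open>\<Delta>' = 2 P \<Delta>\<close>.\<close>

lemma ramanujan_discriminant_eventually_zero:
  fixes S :: "'a::real_normed_field set"
  assumes "open S \<or> convex S" "ramanujan_system_on S P Q R" "x \<in> S"
    and zero: "Q x ^ 3 - (R x)\<^sup>2 = 0"
  shows "\<forall>\<^sub>F y in at x within S. Q y ^ 3 - (R y)\<^sup>2 = 0"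
proof -
  obtain T M where T: "convex T" "x \<in> T" "at x within T = at x within S"
      "ramanujan_system_on T P Q R" "\<And>y. y \<in> T \<Longrightarrow> norm (P y) \<le> M"
    by (rule ramanujan_system_bounded_convex_neighbourhood[OF assms(1-3)], rule that, assumption+)
  let ?D = "\<lambda>y. Q y ^ 3 - (R y)\<^sup>2"
  have "\<forall>\<^sub>F y in at x within T. ?D y = 0"
  proof (rule linear_bound_eventually_zero[OF T(1,2)])
    show "?D x = 0" by (rule zero)
    fix y assume y: "y \<in> T"
    have dQ: "(Q has_field_derivative 2 / 3 * (P y * Q y - R y)) (at y within T)"
      and dR: "(R has_field_derivative P y * R y - (Q y)\<^sup>2) (at y within T)"
      using T(4) y by (auto simp: ramanujan_system_on_def)
    have "(?D has_field_derivative 2 * P y * ?D y) (at y within T)"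
      by (rule derivative_eq_intros dQ dR refl)+
        (simp, simp add: algebra_simps power2_eq_square power3_eq_cube)
    then show "(?D has_derivative (*) (2 * P y * ?D y)) (at y within T)"
      by (rule has_field_derivative_imp_has_derivative)
    fix h
    show "norm (2 * P y * ?D y * h) \<le> 2 * M * norm (?D y) * norm h"
      unfolding norm_mult by (intro mult_right_mono) (use T(5)[OF y] in auto)
  qed
  then show ?thesis by (simp only: T(3))
qed

text \<open>
  With \<open>P\<close> and one factor of \<open>Q\<^sup>2\<close> regarded as coefficients, the equations for \<open>(Q, R)\<close> are
  linear and homogeneous.
\<close>

lemma ramanujan_QR_eventually_zero:
  fixes S :: "'a::real_normed_field set"
  assumes "open S \<or> convex S" "ramanujan_system_on S P Q R" "x \<in> S"
    and zero: "Q x = 0" "R x = 0"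
  shows "\<forall>\<^sub>F y in at x within S. Q y = 0 \<and> R y = 0"
proof -
  obtain T M where T: "convex T" "x \<in> T" "at x within T = at x within S"
      "ramanujan_system_on T P Q R" "M \<ge> 0"
      "\<And>y. y \<in> T \<Longrightarrow> norm (P y) \<le> M" "\<And>y. y \<in> T \<Longrightarrow> norm (Q y) \<le> M"
    by (rule ramanujan_system_bounded_convex_neighbourhood[OF assms(1-3)], rule that, assumption+)
  have "\<forall>\<^sub>F y in at x within T. (Q y, R y) = 0"
  proof (rule linear_bound_eventually_zero[OF T(1,2)])
    show "(Q x, R x) = 0" using zero by (simp add: zero_prod_def)
    fix y assume y: "y \<in> T"
    let ?q = "2 / 3 * (P y * Q y - R y)" and ?r = "P y * R y - (Q y)\<^sup>2"
    show "((\<lambda>y. (Q y, R y)) has_derivative (\<lambda>h. (?q * h, ?r * h))) (at y within T)"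
      using T(4) y unfolding ramanujan_system_on_def
      by (intro has_derivative_Pair has_field_derivative_imp_has_derivative) auto
    fix h
    let ?N = "norm (Q y, R y)"
    have N: "norm (Q y) \<le> ?N" "norm (R y) \<le> ?N"
      by (rule norm_fst_le, rule norm_snd_le)
    have PQ: "norm (P y * Q y) \<le> M * ?N" and PR: "norm (P y * R y) \<le> M * ?N"
      and QQ: "norm ((Q y)\<^sup>2) \<le> M * ?N"
      unfolding norm_mult power2_eq_square using T(5-7) y N by (auto intro: mult_mono)
    have "norm ?q = 2 / 3 * norm (P y * Q y - R y)"
      by (simp only: norm_mult norm_divide norm_numeral)
    also have "\<dots> \<le> norm (P y * Q y - R y)" by simp
    also have "\<dots> \<le> M * ?N + ?N" using norm_triangle_ineq4[of "P y * Q y" "R y"] PQ N by linarith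
    finally have q: "norm ?q \<le> M * ?N + ?N" .
    have r: "norm ?r \<le> M * ?N + M * ?N"
      using norm_triangle_ineq4[of "P y * R y" "(Q y)\<^sup>2"] PR QQ by linarith
    have "norm (?q * h, ?r * h) \<le> norm ?q * norm h + norm ?r * norm h"
      using norm_Pair_le[of "?q * h" "?r * h"] by (simp only: norm_mult)
    also have "\<dots> \<le> (M * ?N + ?N) * norm h + (M * ?N + M * ?N) * norm h"
      by (intro add_mono mult_right_mono q r) auto
    also have "\<dots> = (3 * M + 1) * ?N * norm h" by (simp add: algebra_simps)
    finally show "norm (?q * h, ?r * h) \<le> (3 * M + 1) * ?N * norm h" .
  qed
  then show ?thesis by (simp add: T(3) zero_prod_def)
qed

section \<open>The derivative of a root of the cubic\<close>

text \<open>
  At a limit point of the domain the three cases are: \<open>\<nu>\<close> a simple root, a double root, and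
  a triple root.  At a point that is isolated in \<open>S\<close> every value is a derivative.
\<close>

lemma ramanujan_cubic_root_derivative:
  fixes S :: "'a::real_normed_field set"
  assumes S: "open S \<or> convex S" and sys: "ramanujan_system_on S P Q R"
    and diff: "\<nu> field_differentiable (at x within S)"
    and cubic: "\<And>y. y \<in> S \<Longrightarrow> R y = 3 * Q y * \<nu> y - 4 * \<nu> y ^ 3"
    and x: "x \<in> S"
  shows "(\<nu> has_field_derivative (P x * \<nu> x + 2 * (\<nu> x)\<^sup>2 - Q x) / 3) (at x within S)"
proof (cases "at x within S = bot")
  case True
  then show ?thesis by (simp add: has_field_derivative_iff)
next
  case limit: False
  obtain n where n: "(\<nu> has_field_derivative n) (at x within S)"
    using diff by (auto simp: field_differentiable_def)
  have dQ: "(Q has_field_derivative 2 / 3 * (P x * Q x - R x)) (at x within S)"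
    and dR: "(R has_field_derivative P x * R x - (Q x)\<^sup>2) (at x within S)"
    using sys x by (auto simp: ramanujan_system_on_def)
  have in_S: "\<forall>\<^sub>F y in at x within S. y \<in> S"
    by (simp add: eventually_at_filter)
  have Rx: "R x = 3 * Q x * \<nu> x - 4 * \<nu> x ^ 3" using cubic x .
  have disc: "Q y ^ 3 - (R y)\<^sup>2 = (Q y - 4 * (\<nu> y)\<^sup>2)\<^sup>2 * (Q y - (\<nu> y)\<^sup>2)" if "y \<in> S" for y
    unfolding cubic[OF that] by (simp add: power2_eq_square power3_eq_cube algebra_simps)
  have "3 * n = P x * \<nu> x + 2 * (\<nu> x)\<^sup>2 - Q x"
  proof (cases "Q x = 4 * (\<nu> x)\<^sup>2")
    case False
    let ?F = "\<lambda>y. 3 * Q y * \<nu> y - 4 * \<nu> y ^ 3 - R y"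
    have "(?F has_field_derivative 0) (at x within S)"
      by (rule has_field_derivative_eventually_zero)
        (use in_S cubic x in \<open>auto elim: eventually_mono\<close>)
    moreover have "(?F has_field_derivative
        2 * (P x * Q x - R x) * \<nu> x + 3 * Q x * n - 12 * (\<nu> x)\<^sup>2 * n - (P x * R x - (Q x)\<^sup>2))
        (at x within S)"
      by (rule derivative_eq_intros n dQ dR refl)+ (simp add: algebra_simps)
    ultimately have "2 * (P x * Q x - R x) * \<nu> x + 3 * Q x * n - 12 * (\<nu> x)\<^sup>2 * n
        - (P x * R x - (Q x)\<^sup>2) = 0"
      using has_field_derivative_within_unique limit by blast
    moreover have "2 * (P x * Q x - R x) * \<nu> x + 3 * Q x * n - 12 * (\<nu> x)\<^sup>2 * n
        - (P x * R x - (Q x)\<^sup>2)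
        = (Q x - 4 * (\<nu> x)\<^sup>2) * (3 * n - (P x * \<nu> x + 2 * (\<nu> x)\<^sup>2 - Q x))"
      unfolding Rx by (simp add: power2_eq_square power3_eq_cube algebra_simps)
    ultimately have "(Q x - 4 * (\<nu> x)\<^sup>2) * (3 * n - (P x * \<nu> x + 2 * (\<nu> x)\<^sup>2 - Q x)) = 0"
      by (simp only:)
    then show ?thesis using False by simp
  next
    case double: True
    show ?thesis
    proof (cases "\<nu> x = 0")
      case True
      then have "Q x = 0" "R x = 0" using double Rx by auto
      then have "\<forall>\<^sub>F y in at x within S. Q y = 0 \<and> R y = 0"
        using ramanujan_QR_eventually_zero[OF S sys x] by blast
      then have "\<forall>\<^sub>F y in at x within S. \<nu> y = 0"
        using in_S by eventually_elim (use cubic in auto)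
      then have "(\<nu> has_field_derivative 0) (at x within S)"
        using has_field_derivative_eventually_zero True by blast
      then have "n = 0" using n has_field_derivative_within_unique limit by blast
      then show ?thesis using True \<open>Q x = 0\<close> by simp
    next
      case False
      have "continuous (at x within S) (\<lambda>y. Q y - (\<nu> y)\<^sup>2)"
        using DERIV_continuous[OF dQ] DERIV_continuous[OF n] by (intro continuous_intros)
      moreover have "Q x - (\<nu> x)\<^sup>2 \<noteq> 0" using double False by simp
      ultimately have "\<forall>\<^sub>F y in at x within S. Q y - (\<nu> y)\<^sup>2 \<noteq> 0"
        unfolding continuous_within by (rule tendsto_imp_eventually_ne)
      moreover have "Q x ^ 3 - (R x)\<^sup>2 = 0" using disc[OF x] double by simp
      then have "\<forall>\<^sub>F y in at x within S. Q y ^ 3 - (R y)\<^sup>2 = 0"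
        by (rule ramanujan_discriminant_eventually_zero[OF S sys x])
      ultimately have "\<forall>\<^sub>F y in at x within S. Q y - 4 * (\<nu> y)\<^sup>2 = 0"
        using in_S by eventually_elim (use disc in auto)
      then have "((\<lambda>y. Q y - 4 * (\<nu> y)\<^sup>2) has_field_derivative 0) (at x within S)"
        by (rule has_field_derivative_eventually_zero) (simp add: double)
      moreover have "((\<lambda>y. Q y - 4 * (\<nu> y)\<^sup>2) has_field_derivative
          2 / 3 * (P x * Q x - R x) - 8 * \<nu> x * n) (at x within S)"
        by (rule derivative_eq_intros n dQ refl)+ (simp add: algebra_simps)
      ultimately have "2 / 3 * (P x * Q x - R x) - 8 * \<nu> x * n = 0"
        using has_field_derivative_within_unique limit by blast
      moreover have "2 / 3 * (P x * Q x - R x) - 8 * \<nu> x * n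
          = - 8 / 3 * \<nu> x * (3 * n - (P x * \<nu> x + 2 * (\<nu> x)\<^sup>2 - Q x))"
        unfolding Rx double
        by (simp add: divide_simps, simp add: power2_eq_square power3_eq_cube algebra_simps)
      ultimately have "- 8 / 3 * \<nu> x * (3 * n - (P x * \<nu> x + 2 * (\<nu> x)\<^sup>2 - Q x)) = 0"
        by (simp only:)
      then show ?thesis using False by simp
    qed
  qed
  then have "n = (P x * \<nu> x + 2 * (\<nu> x)\<^sup>2 - Q x) / 3"
    by (simp add: eq_divide_eq mult.commute)
  then show ?thesis using n by (simp only:)
qed

section \<open>The transformed triple\<close>

theorem theorem2p1:
  fixes S :: "'a::real_normed_field set"
    and P Q R \<nu> :: "'a \<Rightarrow> 'a"
  assumes "open S \<or> convex S"
    and "ramanujan_system_on S P Q R"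
    and "\<forall>x\<in>S. \<nu> field_differentiable (at x within S)"
    and "\<forall>x\<in>S. \<nu> x ^ 3 - 3 / 4 * Q x * \<nu> x + 1 / 4 * R x = 0"
  shows "ramanujan_system_on S
    (\<lambda>x. P x - \<nu> x)
    (\<lambda>x. - Q x + 5 * (\<nu> x)\<^sup>2)
    (\<lambda>x. 11 / 4 * R x - 21 / 4 * Q x * \<nu> x)"
proof -
  have cubic: "R x = 3 * Q x * \<nu> x - 4 * \<nu> x ^ 3" if "x \<in> S" for x
  proof -
    have "4 * (\<nu> x ^ 3 - 3 / 4 * Q x * \<nu> x + 1 / 4 * R x) = 0" using assms(4) that by simp
    then show ?thesis by (simp add: algebra_simps)
  qed
  show ?thesis
    unfolding ramanujan_system_on_def
  proof (intro ballI conjI)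
    fix x assume x: "x \<in> S"
    have dP: "(P has_field_derivative 1 / 6 * ((P x)\<^sup>2 - Q x)) (at x within S)"
      and dQ: "(Q has_field_derivative 2 / 3 * (P x * Q x - R x)) (at x within S)"
      and dR: "(R has_field_derivative P x * R x - (Q x)\<^sup>2) (at x within S)"
      using assms(2) x by (auto simp: ramanujan_system_on_def)
    have dn: "(\<nu> has_field_derivative (P x * \<nu> x + 2 * (\<nu> x)\<^sup>2 - Q x) / 3) (at x within S)"
      using ramanujan_cubic_root_derivative[OF assms(1,2) _ cubic x] assms(3) x by blast
    show "((\<lambda>x. P x - \<nu> x) has_field_derivative
        1 / 6 * ((P x - \<nu> x)\<^sup>2 - (- Q x + 5 * (\<nu> x)\<^sup>2))) (at x within S)"
      by (rule derivative_eq_intros dP dn refl)+ (simp add: field_simps power2_eq_square)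
    show "((\<lambda>x. - Q x + 5 * (\<nu> x)\<^sup>2) has_field_derivative
        2 / 3 * ((P x - \<nu> x) * (- Q x + 5 * (\<nu> x)\<^sup>2) - (11 / 4 * R x - 21 / 4 * Q x * \<nu> x)))
        (at x within S)"
      by (rule derivative_eq_intros dQ dn refl)+
        (simp add: cubic[OF x] divide_simps,
          simp add: algebra_simps power2_eq_square power3_eq_cube)
    show "((\<lambda>x. 11 / 4 * R x - 21 / 4 * Q x * \<nu> x) has_field_derivative
        (P x - \<nu> x) * (11 / 4 * R x - 21 / 4 * Q x * \<nu> x) - (- Q x + 5 * (\<nu> x)\<^sup>2)\<^sup>2)
        (at x within S)"
      by (rule derivative_eq_intros dQ dR dn refl)+
        (simp add: cubic[OF x] divide_simps,
          simp add: algebra_simps power2_eq_square power3_eq_cube)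
  qed
qed

end
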